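(* Let $n\ge 2$, let $c>0$, and let $f(x)=e^{cx}-1$ be the weight function of a winners-pay quasi-proportional auction with $n$ bidders having private values $v_1,\dots,v_n>0$. Let $\mathbf{w}=(w_1,\dots,w_n)\in[0,\infty)^n$ have at least two positive entries and satisfy, for every $i\in\{1,\dots,n\}$, $$ w_i \le v_i - \frac{1}{c}\left(1-\frac{1}{e^{c w_i}}\right)\left(\frac{1}{1-a_i(\mathbf{w})}\right), $$ where $a_i(\mathbf{w})$ is the allocation to bidder $i$ when the bid vector is $\mathbf{w}$. Then for every bid vector $\mathbf{b}=(b_1,\dots,b_n)$, $$ (\forall i:\ b_i\ge w_i)\implies(\forall i:\ \mathrm{BR}_i(\mathbf{b})\ge w_i). $$
   Context: Winners-pay quasi-proportional auction: each bidder $i$ submits a bid $b_i\ge 0$. Given the bid vector $\mathbf{b}=(b_1,\dots,b_n)$ and a weight function $f$, bidder $i$ receives the allocation $a_i(\mathbf{b})=\frac{f(b_i)}{\sum_{j=1}^n f(b_j)}$ (defined when the denominator is nonzero) and has utility $u_i(\mathbf{b})=(v_i-b_i)\,a_i(\mathbf{b})$, where $v_i$ is bidder $i$'s private value for a full allocation. For a bid vector $\mathbf{b}$ with at least two positive bids, $\mathrm{BR}_i(\mathbf{b})$, bidder $i$'s best response, is the bid in $[0,\infty)$ that maximizes bidder $i$'s utility when the other bidders' bids are held fixed at $b_j$, $j\ne i$ (for this $f$ the maximizer exists and is unique). *)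

theory Defs
  imports "HOL-Analysis.Analysis"
begin

text \<open>Bidders are indexed by \<open>{1..n}\<close>. Vectors of bids and values are functions \<open>nat \<Rightarrow> real\<close>
  of which only the entries with index in \<open>{1..n}\<close> matter.\<close>

text \<open>If the denominator vanishes, where the allocation is undefined on paper, this is \<open>0\<close>.\<close>

definition allocation :: "(real \<Rightarrow> real) \<Rightarrow> nat \<Rightarrow> (nat \<Rightarrow> real) \<Rightarrow> nat \<Rightarrow> real" where
  "allocation f n b i = f (b i) / (\<Sum>j=1..n. f (b j))"

definition utility ::
  "(real \<Rightarrow> real) \<Rightarrow> nat \<Rightarrow> (nat \<Rightarrow> real) \<Rightarrow> (nat \<Rightarrow> real) \<Rightarrow> nat \<Rightarrow> real" where
  "utility f n v b i = (v i - b i) * allocation f n b i"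

text \<open>As \<open>arg_max\<close> is a choice operator, \<open>best_response\<close> is meaningful only where a maximizer
  over \<open>[0, \<infinity>)\<close> exists and is unique, as it is for \<open>exp_weight c\<close> with \<open>c > 0\<close>, positive values and
  nonnegative bids of which at least two are positive.\<close>

definition best_response ::
  "(real \<Rightarrow> real) \<Rightarrow> nat \<Rightarrow> (nat \<Rightarrow> real) \<Rightarrow> (nat \<Rightarrow> real) \<Rightarrow> nat \<Rightarrow> real" where
  "best_response f n v b i = arg_max (\<lambda>x. utility f n v (b(i := x)) i) (\<lambda>x. x \<ge> 0)"

definition exp_weight :: "real \<Rightarrow> real \<Rightarrow> real" where
  "exp_weight c x = exp (c * x) - 1"

end

theory Submission
  imports Defs
begin

text \<open>With \<open>S\<close> the total weight of the other bids, bidder \<open>i\<close> maximizes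
  \<open>(v - x) f(x) / (f(x) + S)\<close>, whose derivative is positive iff
  \<open>v - x > (1 - exp (-c x)) / c * (1 + f(x) / S)\<close>. The right-hand side increases in \<open>x\<close> and
  decreases in \<open>S\<close>, and \<open>b \<ge> w\<close> only raises \<open>S\<close>; so the hypothesis at \<open>w\<close> makes the utility
  strictly increasing on \<open>[0, w i]\<close>.\<close>

lemma exp_weight_0 [simp]: "exp_weight c 0 = 0"
  by (simp add: exp_weight_def)

lemma exp_weight_mono: "c > 0 \<Longrightarrow> x \<le> y \<Longrightarrow> exp_weight c x \<le> exp_weight c y"
  by (simp add: exp_weight_def)

lemma exp_weight_nonneg: "c > 0 \<Longrightarrow> x \<ge> 0 \<Longrightarrow> exp_weight c x \<ge> 0"
  using exp_weight_mono[of c 0 x] by simp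

lemma exp_weight_pos: "c > 0 \<Longrightarrow> x > 0 \<Longrightarrow> exp_weight c x > 0"
  by (simp add: exp_weight_def)

lemma allocation_eq:
  assumes "i \<in> {1..n}"
  shows "allocation f n b i = f (b i) / (f (b i) + (\<Sum>j\<in>{1..n}-{i}. f (b j)))"
  unfolding allocation_def using sum.remove[OF _ assms, of "\<lambda>j. f (b j)"] by simp

lemma utility_deviation_eq:
  assumes "i \<in> {1..n}"
  shows "utility f n v (b(i := x)) i
    = (v i - x) * (f x / (f x + (\<Sum>j\<in>{1..n}-{i}. f (b j))))"
proof -
  have "(\<Sum>j\<in>{1..n}-{i}. f ((b(i := x)) j)) = (\<Sum>j\<in>{1..n}-{i}. f (b j))"
    by (rule sum.cong) auto
  then show ?thesis
    using allocation_eq[OF assms, of f "b(i := x)"] by (simp add: utility_def)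
qed

text \<open>Two positive bids cannot both belong to bidder \<open>i\<close>, so an opponent with
  positive weight always remains.\<close>

lemma sum_exp_weight_others_pos:
  fixes n :: nat
  assumes "c > 0" "\<forall>j\<in>{1..n}. w j \<ge> 0" "card {j\<in>{1..n}. w j > 0} \<ge> 2"
  shows "(\<Sum>j\<in>{1..n}-{i}. exp_weight c (w j)) > 0"
proof -
  have "\<not> {j\<in>{1..n}. w j > 0} \<subseteq> {i}"
    using assms(3) card_mono[of "{i}" "{j\<in>{1..n}. w j > 0}"] by auto
  then obtain k where "k \<in> {1..n} - {i}" "w k > 0" by auto
  then show ?thesis
    using assms(1,2) exp_weight_pos exp_weight_nonneg by (intro sum_pos2[of _ k]) auto
qed

text \<open>\<open>arg_max\<close> is a choice operator, so its value maximizes once some maximizer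
  exists. Compactness gives one on \<open>{0..v i}\<close>, and bids above \<open>v i\<close> earn
  at most the utility \<open>0\<close> of bidding \<open>0\<close>.\<close>

lemma best_response_is_arg_max:
  assumes "i \<in> {1..n}" "c > 0" "v i > 0"
    and "(\<Sum>j\<in>{1..n}-{i}. exp_weight c (b j)) > 0"
  shows "is_arg_max (\<lambda>x. utility (exp_weight c) n v (b(i := x)) i) (\<lambda>x. x \<ge> 0)
    (best_response (exp_weight c) n v b i)"
proof -
  define S where "S = (\<Sum>j\<in>{1..n}-{i}. exp_weight c (b j))"
  define u where "u x = utility (exp_weight c) n v (b(i := x)) i" for x
  have S: "S > 0" using assms(4) by (simp add: S_def)
  have u: "u = (\<lambda>x. (v i - x) * (exp_weight c x / (exp_weight c x + S)))"
    by (simp add: u_def S_def utility_deviation_eq[OF assms(1)] fun_eq_iff)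
  have pos: "exp_weight c x + S > 0" if "x \<ge> 0" for x
    using exp_weight_nonneg[OF assms(2) that] S by simp
  have "continuous_on {0..v i} u"
    unfolding u using pos
    by (auto intro!: continuous_intros simp: exp_weight_def less_imp_neq[symmetric])
  then obtain m where m: "m \<in> {0..v i}" "\<And>y. y \<in> {0..v i} \<Longrightarrow> u y \<le> u m"
    using continuous_attains_sup[of "{0..v i}" u] assms(3) by auto
  have "u y \<le> u m" if "y \<ge> 0" for y
  proof (cases "y \<le> v i")
    case False
    \<comment> \<open>Above the value the margin \<open>v i - y\<close> is negative while the
      allocation is nonnegative.\<close>
    then have "u y \<le> 0"
      unfolding u using pos[OF that] exp_weight_nonneg[OF assms(2) that]
      by (intro mult_nonpos_nonneg) auto
    also have "0 = u 0" by (simp add: u)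
    also have "\<dots> \<le> u m" using m(2) assms(3) by simp
    finally show ?thesis .
  qed (use m(2) that in auto)
  then have "is_arg_max u (\<lambda>x. x \<ge> 0) m"
    using m(1) by (force simp: is_arg_max_def)
  then show ?thesis
    unfolding best_response_def u_def arg_max_def by (rule someI)
qed

text \<open>Product rule, with \<open>f / (f + S)\<close> having derivative
  \<open>f' * S / (f + S)^2\<close> for \<open>f = exp_weight c\<close>; only the numerator decides
  the sign.\<close>

lemma exp_utility_has_derivative:
  assumes "exp_weight c x + S > 0"
  shows "((\<lambda>x. (v - x) * (exp_weight c x / (exp_weight c x + S))) has_real_derivative
    ((v - x) * c * exp (c * x) * S - exp_weight c x * (exp_weight c x + S))
      / (exp_weight c x + S)\<^sup>2) (at x)"
  using assms unfolding exp_weight_def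
  by (auto intro!: derivative_eq_intros simp: divide_simps power2_eq_square) algebra

lemma exp_utility_strict_increasing:
  assumes "c > 0" "S > 0" "0 \<le> x" "x < w"
    and w: "w \<le> v - 1 / c * (1 - 1 / exp (c * w)) * (1 + exp_weight c w / S)"
  shows "(v - x) * (exp_weight c x / (exp_weight c x + S))
    < (v - w) * (exp_weight c w / (exp_weight c w + S))"
proof (rule DERIV_pos_imp_increasing_open[OF assms(4)])
  have pos: "exp_weight c y + S > 0" if "x \<le> y" for y
    using exp_weight_nonneg[OF assms(1), of y] assms(2,3) that by linarith
  show "continuous_on {x..w} (\<lambda>x. (v - x) * (exp_weight c x / (exp_weight c x + S)))"
    using pos by (auto intro!: continuous_intros simp: exp_weight_def less_imp_neq[symmetric])
  \<comment> \<open>The bound \<open>w\<close> is not strict, so the derivative may vanish at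
    \<open>w\<close> itself; positivity is shown on the open interval, where \<open>y < w\<close>
    supplies the strictness.\<close>
  fix y assume y: "x < y" "y < w"
  have "1 / c * (1 - 1 / exp (c * y)) * (1 + exp_weight c y / S)
      \<le> 1 / c * (1 - 1 / exp (c * w)) * (1 + exp_weight c w / S)"
    using assms(1-4) y exp_weight_nonneg[OF assms(1), of y] exp_weight_mono[OF assms(1), of y w]
    by (intro mult_mono add_mono diff_mono divide_right_mono divide_left_mono) auto
  also have "\<dots> < v - y" using w y by linarith
  \<comment> \<open>The positive factor \<open>c * exp (c * y) * S\<close> clears all denominators
    and turns the inequality into positivity of the numerator of the derivative.\<close>
  finally have "1 / c * (1 - 1 / exp (c * y)) * (1 + exp_weight c y / S)
      * (c * exp (c * y) * S) < (v - y) * (c * exp (c * y) * S)"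
    using assms(1,2) by (intro mult_strict_right_mono) auto
  also have "1 / c * (1 - 1 / exp (c * y)) * (1 + exp_weight c y / S) * (c * exp (c * y) * S)
      = exp_weight c y * (exp_weight c y + S)"
    using assms(1,2) by (simp add: exp_weight_def field_simps)
  finally have "(v - y) * c * exp (c * y) * S - exp_weight c y * (exp_weight c y + S) > 0"
    by (simp add: mult.assoc)
  then show "\<exists>d. ((\<lambda>x. (v - x) * (exp_weight c x / (exp_weight c x + S)))
      has_real_derivative d) (at y) \<and> 0 < d"
    using exp_utility_has_derivative[OF pos, of y v] pos[of y] y
    by (intro exI conjI) (assumption | force)+
qed

theorem theorem2p3:
  fixes n :: nat and c :: real and v w :: "nat \<Rightarrow> real"
  assumes "n \<ge> 2" and "c > 0"
    and "\<forall>i\<in>{1..n}. v i > 0"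
    and "\<forall>i\<in>{1..n}. w i \<ge> 0"
    and "card {i\<in>{1..n}. w i > 0} \<ge> 2"
    and "\<forall>i\<in>{1..n}. w i \<le> v i - 1 / c * (1 - 1 / exp (c * w i))
           * (1 / (1 - allocation (exp_weight c) n w i))"
  shows "\<forall>b :: nat \<Rightarrow> real. (\<forall>i\<in>{1..n}. b i \<ge> 0) \<longrightarrow> (\<forall>i\<in>{1..n}. b i \<ge> w i) \<longrightarrow>
           (\<forall>i\<in>{1..n}. best_response (exp_weight c) n v b i \<ge> w i)"
proof (intro allI impI ballI)
  fix b :: "nat \<Rightarrow> real" and i
  assume b: "\<forall>i\<in>{1..n}. b i \<ge> w i" and i: "i \<in> {1..n}"
  define S where "S = (\<Sum>j\<in>{1..n}-{i}. exp_weight c (b j))"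
  define T where "T = (\<Sum>j\<in>{1..n}-{i}. exp_weight c (w j))"
  define m where "m = best_response (exp_weight c) n v b i"
  have T: "T > 0"
    unfolding T_def using assms(2,4,5) by (rule sum_exp_weight_others_pos)
  have TS: "T \<le> S"
    unfolding T_def S_def using b assms(2) by (intro sum_mono exp_weight_mono) auto
  have wi: "w i \<ge> 0" and fw: "exp_weight c (w i) \<ge> 0"
    using assms(4) i exp_weight_nonneg[OF assms(2)] by auto
  have "is_arg_max (\<lambda>x. utility (exp_weight c) n v (b(i := x)) i) (\<lambda>x. x \<ge> 0) m"
    unfolding m_def using i assms(2,3) T TS
    by (intro best_response_is_arg_max) (auto simp: S_def)
  then have m: "m \<ge> 0" and max: "\<not> utility (exp_weight c) n v (b(i := m)) i
      < utility (exp_weight c) n v (b(i := w i)) i"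
    using wi by (auto simp: is_arg_max_def)
  \<comment> \<open>The share left to the others is \<open>T / (exp_weight c (w i) + T)\<close>; its
    reciprocal brings the hypothesis into the form with the opponents' weight.\<close>
  have "1 / (1 - allocation (exp_weight c) n w i) = 1 + exp_weight c (w i) / T"
    unfolding allocation_eq[OF i] T_def[symmetric] using T fw by (simp add: field_simps)
  then have "w i \<le> v i - 1 / c * (1 - 1 / exp (c * w i)) * (1 + exp_weight c (w i) / T)"
    using assms(6) i by metis
  \<comment> \<open>Passing from \<open>T\<close> to the larger \<open>S\<close> shrinks the
    subtracted term, since its first factor is nonnegative by \<open>w i \<ge> 0\<close>.\<close>
  also have "\<dots> \<le> v i - 1 / c * (1 - 1 / exp (c * w i)) * (1 + exp_weight c (w i) / S)"
    using T TS wi fw assms(2)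
    by (intro diff_mono mult_left_mono add_mono divide_left_mono) auto
  \<comment> \<open>If \<open>m < w i\<close>, strict increase would make \<open>w i\<close> a
    better bid than the maximizer \<open>m\<close>.\<close>
  finally show "m \<ge> w i"
    using exp_utility_strict_increasing[of c S m "w i" "v i"] assms(2) T TS m max
    unfolding utility_deviation_eq[OF i] S_def[symmetric] by linarith
qed

end
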